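(* Let $r>0$, let $B(0,r)\subset\mathbb{R}^2$ be the open disk of radius $r$ centred at the origin, and let $w(x):=\left(\frac{x_1}{4},\frac{x_2}{4},-\frac{x_3}{2}\right)$ for $x=(x_1,x_2,x_3)\in\mathbb{R}^3$. For either choice of the sign $\pm$, the function $$u(x)=\pm\frac{3}{4}\left[\log\left(\frac{x_1^2+x_2^2}{r^2}\right)\right](-x_2,x_1,0)+w(x)$$ satisfies $$V(e(u))=0\ \text{ a.e. in } B(0,r)\times\mathbb{R},\qquad u=w\ \text{ on }\partial(B(0,r)\times\mathbb{R}),$$ and belongs to $W^{1,p}_{loc}(B(0,r)\times\mathbb{R};\mathbb{R}^3)$ for every $1\leq p<\infty$.
   Context: For a displacement $u$ with values in $\mathbb{R}^3$, $e(u):=\frac12(\nabla u+(\nabla u)^T)$ is the symmetric part of the (weak) gradient. For every symmetric matrix $E\in\mathbb{R}^{3\times 3}$ with $\operatorname{tr}E=0$, $$V(E):=\min_{n\in S^2}|E-U_n|^2,\qquad U_n:=\frac12(3\,n\otimes n-I),$$ where $|\cdot|$ is the Euclidean (Frobenius) norm on matrices, $S^2$ is the unit sphere of $\mathbb{R}^3$, and $I$ is the identity matrix. On the axis $x_1=x_2=0$ the first summand in the definition of $u$ is understood as its continuous extension, $0$. *)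

theory Defs
  imports "HOL-Analysis.Analysis"
begin

definition partial :: "'n \<Rightarrow> (real^'n \<Rightarrow> real) \<Rightarrow> real^'n \<Rightarrow> real"
  where "partial j f x = frechet_derivative f (at x) (axis j 1)"

primrec Ck :: "nat \<Rightarrow> (real^'n \<Rightarrow> real) \<Rightarrow> bool" where
  "Ck 0 f \<longleftrightarrow> continuous_on UNIV f"
| "Ck (Suc k) f \<longleftrightarrow> (\<forall>x. f differentiable (at x)) \<and> (\<forall>j. Ck k (partial j f))"

text \<open>The space of test functions \<open>C\<^sub>c\<^sup>\<infinity>(S)\<close>; its members are extended by zero to the whole space.\<close>

definition test_fun :: "(real^'n) set \<Rightarrow> (real^'n \<Rightarrow> real) \<Rightarrow> bool"
  where "test_fun S \<phi> \<longleftrightarrow> (\<forall>k. Ck k \<phi>) \<and>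
           compact (closure {x. \<phi> x \<noteq> 0}) \<and> closure {x. \<phi> x \<noteq> 0} \<subseteq> S"

definition locally_integrable :: "'a::euclidean_space set \<Rightarrow> ('a \<Rightarrow> 'b::euclidean_space) \<Rightarrow> bool"
  where "locally_integrable S f \<longleftrightarrow> (\<forall>K. compact K \<and> K \<subseteq> S \<longrightarrow> set_integrable lebesgue K f)"

text \<open>The entry in row \<open>i\<close> and column \<open>j\<close> of a weak gradient is the weak derivative of \<open>u\<^sub>i\<close>
  in direction \<open>j\<close>. A weak gradient is determined only up to a null set, so being one is
  a relation, like \<^const>\<open>has_derivative\<close>.\<close>

definition has_weak_gradient ::
    "(real^'n) set \<Rightarrow> (real^'n \<Rightarrow> real^'m) \<Rightarrow> (real^'n \<Rightarrow> real^'n^'m) \<Rightarrow> bool"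
  where "has_weak_gradient S u G \<longleftrightarrow>
    locally_integrable S u \<and> locally_integrable S G \<and>
    (\<forall>\<phi> i j. test_fun S \<phi> \<longrightarrow>
       (LINT x:S|lebesgue. u x $ i * partial j \<phi> x) = - (LINT x:S|lebesgue. G x $ i $ j * \<phi> x))"

definition Lp :: "real \<Rightarrow> 'a::euclidean_space set \<Rightarrow> ('a \<Rightarrow> 'b::euclidean_space) \<Rightarrow> bool"
  where "Lp p S f \<longleftrightarrow> set_borel_measurable lebesgue S f \<and>
           set_integrable lebesgue S (\<lambda>x. norm (f x) powr p)"

definition W1p :: "real \<Rightarrow> (real^'n) set \<Rightarrow> (real^'n \<Rightarrow> real^'m) \<Rightarrow> bool"
  where "W1p p S u \<longleftrightarrow> Lp p S u \<and> (\<exists>G. has_weak_gradient S u G \<and> Lp p S G)"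

definition W1p_loc :: "real \<Rightarrow> (real^'n) set \<Rightarrow> (real^'n \<Rightarrow> real^'m) \<Rightarrow> bool"
  where "W1p_loc p S u \<longleftrightarrow>
    (\<forall>T. open T \<and> compact (closure T) \<and> closure T \<subseteq> S \<longrightarrow> W1p p T u)"

definition sym_part :: "real^'n^'n \<Rightarrow> real^'n^'n"
  where "sym_part A = (1/2) *\<^sub>R (A + transpose A)"

definition U :: "real^3 \<Rightarrow> real^3^3"
  where "U n = (1/2) *\<^sub>R (3 *\<^sub>R (\<chi> i j. n $ i * n $ j) - mat 1)"

text \<open>The norm on matrices is the Frobenius norm. The formula for \<open>V\<close> makes sense for every
  matrix; since each \<open>U n\<close> with \<open>n\<close> in the sphere is symmetric and trace-free, \<open>V E = 0\<close> forces
  \<open>E\<close> to be symmetric and trace-free as well.\<close>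

definition V :: "real^3^3 \<Rightarrow> real"
  where "V E = (LEAST v. v \<in> (\<lambda>n. (norm (E - U n))\<^sup>2) ` sphere 0 1)"

lemma V_minimum:
  shows "\<exists>n\<in>sphere 0 1. V E = (norm (E - U n))\<^sup>2"
    and "n \<in> sphere 0 1 \<Longrightarrow> V E \<le> (norm (E - U n))\<^sup>2"
proof -
  define f where "f n = (norm (E - U n))\<^sup>2" for n
  have "continuous_on (sphere 0 1) f"
    unfolding f_def U_def by (intro continuous_intros)
  moreover have "sphere (0::real^3) 1 \<noteq> {}"
    by simp
  ultimately have "\<exists>m\<in>sphere 0 1. \<forall>n\<in>sphere 0 1. f m \<le> f n"
    using continuous_attains_inf[OF compact_sphere] by blast
  then obtain m where m: "m \<in> sphere 0 1" and min: "\<forall>n\<in>sphere 0 1. f m \<le> f n"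
    by blast
  have "V E = (LEAST v. v \<in> f ` sphere 0 1)"
    unfolding V_def f_def ..
  also have "\<dots> = f m"
  proof (rule Least_equality)
    show "f m \<in> f ` sphere 0 1" using m by (rule imageI)
    show "f m \<le> y" if "y \<in> f ` sphere 0 1" for y using that min by blast
  qed
  finally have VE: "V E = f m" .
  show "\<exists>n\<in>sphere 0 1. V E = (norm (E - U n))\<^sup>2"
    using m VE unfolding f_def by blast
  show "V E \<le> (norm (E - U n))\<^sup>2" if "n \<in> sphere 0 1"
    using min that VE unfolding f_def by simp
qed

definition cylinder :: "real \<Rightarrow> (real^3) set"
  where "cylinder r = {x. (vector [x $ 1, x $ 2] :: real^2) \<in> ball 0 r}"

definition w :: "real^3 \<Rightarrow> real^3"
  where "w x = vector [x $ 1 / 4, x $ 2 / 4, - (x $ 3) / 2]"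

text \<open>The parameter \<open>s\<close> is the sign. On the axis the vector factor vanishes and \<open>ln 0\<close> is a
  real number, so the first summand is \<open>0\<close> there, its continuous extension.\<close>

definition u :: "real \<Rightarrow> real \<Rightarrow> real^3 \<Rightarrow> real^3"
  where "u s r x =
    (s * (3/4) * ln (((x $ 1)\<^sup>2 + (x $ 2)\<^sup>2) / r\<^sup>2)) *\<^sub>R vector [- (x $ 2), x $ 1, 0] + w x"

end

theory Submission imports Defs begin

text \<open>Off the axis \<open>x $ 1 = x $ 2 = 0\<close> the map \<open>u s r\<close> is smooth, with gradient \<open>grad_u s r\<close>. The
  logarithm itself cancels in the symmetric part, because it multiplies an antisymmetric matrix; what
  remains is exactly \<open>U n\<close>, where \<open>n\<close> is the horizontal radial direction turned by \<open>45\<close> degrees, the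
  sense of rotation being given by \<open>s\<close> (\<open>V_sym_part_grad_u\<close>). On the lateral boundary the logarithm is
  \<open>ln 1 = 0\<close>, so there \<open>u = w\<close>.

  What has to be argued is that the pointwise gradient is also the weak gradient across the axis, and
  that it is in \<open>L\<^sup>p\<close> on bounded sets. The first holds because \<open>u\<close> is continuous everywhere
  (\<open>continuous_coordinate_ln_ratio\<close>) and, on each line parallel to a coordinate axis, differentiable in
  the direction of that line up to at most one point (\<open>u_line_derivative\<close>). The fundamental theorem of
  calculus holds on such lines without a boundary term at the exceptional point, and Fubini's theorem
  yields integration by parts against test functions (\<open>has_weak_gradient_by_lines\<close>).
  For the second, the gradient is bounded by a multiple of \<open>1 + \<bar>ln (\<rho>\<^sup>2 / r\<^sup>2)\<bar>\<close>, with \<open>\<rho>\<close>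
  the distance to the axis. On bounded sets this is at most a multiple of \<open>\<bar>x $ 1\<bar> powr (-d)\<close> for every \<open>d > 0\<close>, and for
  \<open>d = 1/(2*p)\<close> the \<open>p\<close>-th power of the latter is locally integrable
  (\<open>norm_grad_u_powr_integrable\<close>).\<close>

section \<open>Weak gradients from derivatives along coordinate lines\<close>

text \<open>The fundamental theorem of calculus for the gauge integral tolerates finitely many
  points without a derivative, provided the primitive stays continuous there. If \<open>h'\<close> fails to be
  Lebesgue integrable, its Bochner integral is \<open>0\<close> by convention; this covers the
  null set of lines on which Fubini's theorem gives no integrability.\<close>

lemma integral_derivative_compact_support_eq_0:
  fixes h h' :: "real \<Rightarrow> real"
  assumes cont: "continuous_on UNIV h"
    and fin: "finite F"
    and deriv: "\<And>t. t \<notin> F \<Longrightarrow> (h has_real_derivative h' t) (at t)"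
    and h0: "\<And>t. \<bar>t\<bar> \<ge> R \<Longrightarrow> h t = 0"
    and h'0: "\<And>t. \<bar>t\<bar> \<ge> R \<Longrightarrow> h' t = 0"
  shows "(LINT t|lborel. h' t) = 0"
proof (cases "integrable lborel h'")
  case True
  \<comment> \<open>the sign of \<open>R\<close> is arbitrary, and the interval must not be reversed\<close>
  define a where "a = \<bar>R\<bar>"
  have "(h' has_integral (h a - h (-a))) {-a..a}"
  proof (rule fundamental_theorem_of_calculus_strong[OF fin])
    show "-a \<le> a" by (simp add: a_def)
    show "continuous_on {-a..a} h" using cont continuous_on_subset by blast
    show "(h has_vector_derivative h' t) (at t)" if "t \<in> {-a..a} - F" for t
      using deriv[of t] that by (simp add: has_real_derivative_iff_has_vector_derivative)
  qed
  moreover have "h a - h (-a) = 0"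
    using h0[of a] h0[of "-a"] by (simp add: a_def)
  ultimately have "(h' has_integral 0) {-a..a}" by simp
  then have "(h' has_integral 0) UNIV"
  proof (rule has_integral_on_superset)
    show "h' t = 0" if "t \<notin> {-a..a}" for t
      using that by (intro h'0) (auto simp: a_def)
  qed simp
  with has_integral_integral_lborel[OF True] show ?thesis
    by (rule has_integral_unique)
qed (rule not_integrable_integral_eq)

text \<open>Fubini's theorem, for one coordinate against the remaining ones: Lebesgue measure is the
  image of the product measure over the basis, and one factor is split off.\<close>

lemma lborel_integral_eq_0_by_lines:
  fixes f :: "'a::euclidean_space \<Rightarrow> real"
  assumes int: "integrable lborel f" and b: "b \<in> Basis"
    and lines: "\<And>x. (LINT t|lborel. f (x + t *\<^sub>R b)) = 0"
  shows "(LINT x|lborel. f x) = 0"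
proof -
  interpret product_sigma_finite "\<lambda>_::'a. lborel :: real measure" ..
  let ?B = "Basis - {b}"
  let ?e = "\<lambda>y. \<Sum>c\<in>Basis. y c *\<^sub>R c :: 'a"
  let ?P = "\<lambda>I. Pi\<^sub>M I (\<lambda>_::'a. lborel :: real measure)"
  have ins: "insert b ?B = Basis" using b by auto
  have eq: "(lborel :: 'a measure) = distr (?P Basis) borel ?e"
    by (rule lborel_eq)
  have m: "?e \<in> measurable (?P Basis) borel" by measurable
  have f: "f \<in> borel_measurable borel" using int by auto
  have "(LINT x|lborel. f x) = (LINT y|?P Basis. f (?e y))"
    by (subst eq) (rule integral_distr[OF m f])
  also have "\<dots> = (LINT y|?P ?B. (LINT t|lborel. f (?e (y(b := t)))))"
  proof -
    have "integrable (?P Basis) (\<lambda>y. f (?e y))"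
      using int by (subst (asm) eq) (simp add: integrable_distr_eq[OF m f])
    then show ?thesis
      using product_integral_insert[of ?B b "\<lambda>y. f (?e y)"] unfolding ins by simp
  qed
  also have "\<dots> = (LINT y|?P ?B. 0)"
  proof (rule Bochner_Integration.integral_cong[OF refl])
    fix y :: "'a \<Rightarrow> real"
    have "?e (y(b := t)) = (\<Sum>c\<in>?B. y c *\<^sub>R c) + t *\<^sub>R b" for t
      using b by (subst sum.remove[OF finite_Basis b]) (simp add: add.commute)
    then show "(LINT t|lborel. f (?e (y(b := t)))) = 0"
      using lines by simp
  qed
  finally show ?thesis by simp
qed

lemma test_fun_facts:
  fixes \<phi> :: "real^'n \<Rightarrow> real"
  assumes "test_fun S \<phi>"
  shows test_fun_differentiable: "\<phi> differentiable (at x)"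
    and test_fun_continuous: "continuous_on T \<phi>"
    and test_fun_partial_continuous: "continuous_on T (partial j \<phi>)"
    and test_fun_compact_support: "compact (closure {x. \<phi> x \<noteq> 0})" "closure {x. \<phi> x \<noteq> 0} \<subseteq> S"
proof -
  have "Ck (Suc 0) \<phi>" using assms unfolding test_fun_def by blast
  then have d: "\<phi> differentiable (at x)" and p: "continuous_on UNIV (partial j \<phi>)" for x j by auto
  show "\<phi> differentiable (at x)" by (rule d)
  show "continuous_on T \<phi>"
    using d by (intro continuous_at_imp_continuous_on ballI differentiable_imp_continuous_within)
  show "continuous_on T (partial j \<phi>)" using p continuous_on_subset by blast
  show "compact (closure {x. \<phi> x \<noteq> 0})" "closure {x. \<phi> x \<noteq> 0} \<subseteq> S"
    using assms unfolding test_fun_def by auto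
qed

lemma vanish_off_support:
  fixes \<phi> :: "real^'n \<Rightarrow> real"
  assumes "x \<notin> closure {x. \<phi> x \<noteq> 0}"
  shows "\<phi> x = 0" and "partial j \<phi> x = 0"
proof -
  define O' where "O' = - closure {x. \<phi> x \<noteq> 0}"
  have z: "\<phi> y = 0" if "y \<in> O'" for y
    using that closure_subset[of "{x. \<phi> x \<noteq> 0}"] unfolding O'_def by blast
  have O': "open O'" "x \<in> O'" using assms unfolding O'_def by blast+
  show "\<phi> x = 0" by (rule z[OF O'(2)])
  have "(\<phi> has_derivative (\<lambda>_. 0)) (at x)"
    by (rule has_derivative_transform_within_open[OF has_derivative_const O' z[symmetric]])
  then have "frechet_derivative \<phi> (at x) = (\<lambda>_. 0)"
    by (rule frechet_derivative_at[symmetric])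
  then show "partial j \<phi> x = 0" by (simp add: partial_def)
qed

lemma locally_integrable_UNIV_lborel:
  fixes g :: "'a::euclidean_space \<Rightarrow> 'b::euclidean_space"
  assumes "locally_integrable UNIV g" "g \<in> borel_measurable borel" "compact K"
  shows "set_integrable lborel K g"
proof -
  have "K \<in> sets borel" using assms(3) by (simp add: borel_compact)
  then have "(\<lambda>x. indicator K x *\<^sub>R g x) \<in> borel_measurable lborel"
    using assms(2) by measurable
  moreover have "integrable lebesgue (\<lambda>x. indicator K x *\<^sub>R g x)"
    using assms(1,3) by (simp add: locally_integrable_def set_integrable_def)
  ultimately show ?thesis
    using integrable_completion[of "\<lambda>x. indicator K x *\<^sub>R g x" lborel]
    by (simp add: set_integrable_def)
qed

text \<open>The product \<open>f * \<phi>\<close> has compact support and is an antiderivative of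
  \<open>f * partial j \<phi> + g * \<phi>\<close> along every line parallel to the \<open>j\<close>-th axis, apart from finitely many
  points. Hence the latter integrates to \<open>0\<close> over each such line, and by Fubini over the whole space.
  The exceptional set depends on the line, so the union of these sets can be a whole axis.\<close>

lemma integration_by_parts_along_lines:
  fixes f g \<phi> :: "real^'n \<Rightarrow> real"
  assumes f: "continuous_on UNIV f"
    and g: "g \<in> borel_measurable borel" "locally_integrable UNIV g"
    and deriv: "\<And>x. \<exists>F. finite F \<and> (\<forall>t. t \<notin> F \<longrightarrow>
      ((\<lambda>t. f (x + t *\<^sub>R axis j 1)) has_real_derivative g (x + t *\<^sub>R axis j 1)) (at t))"
    and \<phi>: "test_fun S \<phi>"
  shows "(LINT x|lborel. f x * partial j \<phi> x) = - (LINT x|lborel. g x * \<phi> x)"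
proof -
  define K where "K = closure {x. \<phi> x \<noteq> 0}"
  let ?e = "axis j 1 :: real^'n"
  note K = test_fun_compact_support(1)[OF \<phi>, folded K_def]
  note vanish = vanish_off_support[of _ \<phi>, folded K_def]
  have I1: "integrable lborel (\<lambda>x. f x * partial j \<phi> x)"
  proof -
    have "continuous_on K (\<lambda>x. f x * partial j \<phi> x)"
      by (intro continuous_on_mult test_fun_partial_continuous[OF \<phi>] continuous_on_subset[OF f]) auto
    from borel_integrable_compact[OF K this]
    show ?thesis
      by (rule iffD1[OF Bochner_Integration.integrable_cong[OF refl], rotated])
        (auto simp: indicator_def vanish)
  qed
  have I2: "integrable lborel (\<lambda>x. g x * \<phi> x)"
  proof -
    have mphi: "\<phi> \<in> borel_measurable borel"
      by (rule borel_measurable_continuous_onI[OF test_fun_continuous[OF \<phi>]])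
    obtain M where M: "\<And>x. x \<in> K \<Longrightarrow> \<bar>\<phi> x\<bar> \<le> M"
    proof -
      have "bounded (\<phi> ` K)"
        by (rule compact_imp_bounded[OF compact_continuous_image[OF test_fun_continuous[OF \<phi>] K]])
      then obtain M where "\<forall>y\<in>\<phi> ` K. norm y \<le> M" unfolding bounded_iff ..
      then show ?thesis by (intro that[of M]) simp
    qed
    have "integrable lborel (\<lambda>x. indicator K x *\<^sub>R g x)"
      using locally_integrable_UNIV_lborel[OF g(2,1) K] by (simp add: set_integrable_def)
    then have "integrable lborel (\<lambda>x. M * (indicator K x *\<^sub>R g x))"
      by (intro integrable_mult_right)
    then show ?thesis
    proof (rule Bochner_Integration.integrable_bound)
      show "(\<lambda>x. g x * \<phi> x) \<in> borel_measurable lborel"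
        using g(1) mphi by measurable
      have "norm (g x * \<phi> x) \<le> norm (M * (indicator K x *\<^sub>R g x))" for x
      proof (cases "x \<in> K")
        case True
        have "\<bar>g x\<bar> * \<bar>\<phi> x\<bar> \<le> \<bar>g x\<bar> * \<bar>M\<bar>"
          using M[OF True] by (intro mult_left_mono) auto
        then show ?thesis using True by (simp add: abs_mult mult.commute)
      qed (simp add: vanish)
      then show "AE x in lborel. norm (g x * \<phi> x) \<le> norm (M * (indicator K x *\<^sub>R g x))" by simp
    qed
  qed
  obtain R where R: "\<And>x. x \<in> K \<Longrightarrow> norm x < R"
    using compact_imp_bounded[OF K] unfolding bounded_pos_less by auto
  have "(LINT x|lborel. f x * partial j \<phi> x + g x * \<phi> x) = 0"
  proof (rule lborel_integral_eq_0_by_lines)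
    show "integrable lborel (\<lambda>x. f x * partial j \<phi> x + g x * \<phi> x)"
      using I1 I2 by (rule Bochner_Integration.integrable_add)
    show "?e \<in> Basis" by (simp add: axis_in_Basis_iff)
    fix x :: "real^'n"
    let ?l = "\<lambda>t. x + t *\<^sub>R ?e"
    obtain F where F: "finite F"
      "\<And>t. t \<notin> F \<Longrightarrow> ((\<lambda>t. f (?l t)) has_real_derivative g (?l t)) (at t)"
      using deriv by blast
    have out: "?l t \<notin> K" if "\<bar>t\<bar> \<ge> R + norm x" for t
    proof
      assume "?l t \<in> K"
      then have "norm (?l t) < R" by (rule R)
      moreover have "norm (t *\<^sub>R ?e) \<le> norm (?l t) + norm x"
        using norm_triangle_ineq4[of "?l t" x] by simp
      ultimately show False using that by simp
    qed
    have dphi: "((\<lambda>t. \<phi> (?l t)) has_real_derivative partial j \<phi> (?l t)) (at t)" for t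
    proof -
      have "(\<phi> has_derivative frechet_derivative \<phi> (at (?l t))) (at (?l t))"
        using test_fun_differentiable[OF \<phi>] frechet_derivative_works by blast
      moreover have "(?l has_vector_derivative ?e) (at t)"
        by (auto intro!: derivative_eq_intros)
      ultimately have "((\<phi> \<circ> ?l) has_vector_derivative frechet_derivative \<phi> (at (?l t)) ?e) (at t)"
        by (metis has_derivative_at_withinI vector_derivative_diff_chain_within)
      then show ?thesis
        by (simp add: has_real_derivative_iff_has_vector_derivative partial_def o_def)
    qed
    show "(LINT t|lborel. f (?l t) * partial j \<phi> (?l t) + g (?l t) * \<phi> (?l t)) = 0"
    proof (rule integral_derivative_compact_support_eq_0[OF _ F(1)])
      show "continuous_on UNIV (\<lambda>t. f (?l t) * \<phi> (?l t))"
        by (intro continuous_intros continuous_on_compose2[OF f]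
            continuous_on_compose2[OF test_fun_continuous[OF \<phi>, of UNIV]]) auto
      show "((\<lambda>t. f (?l t) * \<phi> (?l t)) has_real_derivative
          f (?l t) * partial j \<phi> (?l t) + g (?l t) * \<phi> (?l t)) (at t)" if "t \<notin> F" for t
        using DERIV_mult[OF F(2)[OF that] dphi] by (simp add: algebra_simps)
      show "f (?l t) * \<phi> (?l t) = 0" if "\<bar>t\<bar> \<ge> R + norm x" for t
        using vanish[OF out[OF that]] by simp
      show "f (?l t) * partial j \<phi> (?l t) + g (?l t) * \<phi> (?l t) = 0" if "\<bar>t\<bar> \<ge> R + norm x" for t
        using vanish[OF out[OF that]] by simp
    qed
  qed
  then show ?thesis
    using Bochner_Integration.integral_add[OF I1 I2] by linarith
qed

lemma locally_integrable_component:
  fixes G :: "'a::euclidean_space \<Rightarrow> 'b::euclidean_space"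
  assumes "locally_integrable S G" "bounded_linear L"
  shows "locally_integrable S (\<lambda>x. L (G x) :: 'c::euclidean_space)"
  unfolding locally_integrable_def
proof (intro allI impI)
  fix K assume "compact K \<and> K \<subseteq> S"
  then have "integrable lebesgue (\<lambda>x. indicator K x *\<^sub>R G x)"
    using assms(1) by (simp add: locally_integrable_def set_integrable_def)
  from integrable_bounded_linear[OF assms(2) this]
  show "set_integrable lebesgue K (\<lambda>x. L (G x))"
    by (simp add: set_integrable_def linear_simps[OF assms(2)])
qed

lemma locally_integrable_continuous:
  fixes f :: "'a::euclidean_space \<Rightarrow> 'b::euclidean_space"
  assumes "continuous_on UNIV f"
  shows "locally_integrable S f"
  unfolding locally_integrable_def
proof (intro allI impI)
  fix K assume "compact K \<and> K \<subseteq> S"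
  then have "integrable lborel (\<lambda>x. indicator K x *\<^sub>R f x)"
    by (intro borel_integrable_compact continuous_on_subset[OF assms]) auto
  then show "set_integrable lebesgue K f"
    using integrable_completion[of "\<lambda>x. indicator K x *\<^sub>R f x" lborel]
    by (auto simp: set_integrable_def)
qed

lemma set_integral_lebesgue_restrict:
  fixes f :: "'a::euclidean_space \<Rightarrow> real"
  assumes "f \<in> borel_measurable borel" "\<And>x. x \<notin> S \<Longrightarrow> f x = 0"
  shows "(LINT x:S|lebesgue. f x) = (LINT x|lborel. f x)"
proof -
  have "(\<lambda>x. indicator S x *\<^sub>R f x) = f"
  proof
    show "indicator S x *\<^sub>R f x = f x" for x
      using assms(2)[of x] by (cases "x \<in> S") auto
  qed
  then show ?thesis
    using integral_completion[of f lborel] assms(1) by (simp add: set_lebesgue_integral_def)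
qed

text \<open>Test functions vanish off their domain \<open>S\<close>, so a weak gradient on the whole space is one
  on every \<open>S\<close>; this is what makes the same \<open>G\<close> serve the cylinder and all its subdomains.\<close>

lemma has_weak_gradient_by_lines:
  fixes f :: "real^'n \<Rightarrow> real^'m"
  assumes f: "continuous_on UNIV f"
    and G: "G \<in> borel_measurable borel" "locally_integrable UNIV G"
    and deriv: "\<And>x i j. \<exists>F. finite F \<and> (\<forall>t. t \<notin> F \<longrightarrow>
      ((\<lambda>t. f (x + t *\<^sub>R axis j 1) $ i) has_real_derivative G (x + t *\<^sub>R axis j 1) $ i $ j) (at t))"
  shows "has_weak_gradient S f G"
  unfolding has_weak_gradient_def
proof (intro conjI allI impI)
  show "locally_integrable S f" by (rule locally_integrable_continuous[OF f])
  show "locally_integrable S G" using G(2) by (simp add: locally_integrable_def)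
  fix \<phi> :: "real^'n \<Rightarrow> real" and i j assume \<phi>: "test_fun S \<phi>"
  have out: "\<phi> x = 0" "partial j \<phi> x = 0" if "x \<notin> S" for x
    using vanish_off_support[of x \<phi>] test_fun_compact_support(2)[OF \<phi>] that by auto
  have bl: "bounded_linear (\<lambda>A::real^'n^'m. A $ i $ j)"
    by (rule bounded_linear_compose[OF bounded_linear_vec_nth bounded_linear_vec_nth])
  have fi: "continuous_on UNIV (\<lambda>x. f x $ i)" by (intro continuous_intros f)
  have gm: "(\<lambda>x. G x $ i $ j) \<in> borel_measurable borel"
    using measurable_compose[OF G(1) borel_measurable_continuous_onI[OF linear_continuous_on[OF bl]]] .
  have p: "partial j \<phi> \<in> borel_measurable borel" "\<phi> \<in> borel_measurable borel"
      "(\<lambda>x. f x $ i) \<in> borel_measurable borel"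
    by (rule borel_measurable_continuous_onI test_fun_partial_continuous[OF \<phi>]
          test_fun_continuous[OF \<phi>] fi)+
  have "(LINT x:S|lebesgue. f x $ i * partial j \<phi> x) = (LINT x|lborel. f x $ i * partial j \<phi> x)"
    by (rule set_integral_lebesgue_restrict) (use p out in auto)
  also have "\<dots> = - (LINT x|lborel. G x $ i $ j * \<phi> x)"
    by (rule integration_by_parts_along_lines[OF fi gm
          locally_integrable_component[OF G(2) bl] deriv \<phi>])
  also have "(LINT x|lborel. G x $ i $ j * \<phi> x) = (LINT x:S|lebesgue. G x $ i $ j * \<phi> x)"
    by (rule set_integral_lebesgue_restrict[symmetric]) (use p gm out in auto)
  finally show "(LINT x:S|lebesgue. f x $ i * partial j \<phi> x) = - (LINT x:S|lebesgue. G x $ i $ j * \<phi> x)" .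
qed

section \<open>Bounds for the logarithm and an integrable singularity\<close>

text \<open>The only fact about the logarithm behind all estimates below: it is dominated by an
  arbitrarily small power, at \<open>0\<close> and at infinity. It is \<open>1 + z \<le> exp z\<close> for
  \<open>z = a * ln y\<close> and for \<open>z = - a * ln y\<close>.\<close>

lemma abs_ln_le_powr:
  fixes y a :: real
  assumes "y > 0" "a > 0"
  shows "\<bar>ln y\<bar> \<le> (y powr a + y powr (-a)) / a"
proof -
  have "a * ln y \<le> y powr a" "a * - ln y \<le> y powr (-a)"
    using exp_ge_add_one_self[of "a * ln y"] exp_ge_add_one_self[of "- (a * ln y)"] assms
    unfolding powr_def by (simp_all, linarith)
  then have "\<bar>a * ln y\<bar> \<le> y powr a + y powr (-a)"
    using powr_ge_zero[of y a] powr_ge_zero[of y "-a"] by linarith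
  then have "a * \<bar>ln y\<bar> \<le> y powr a + y powr (-a)"
    using assms(2) by (simp add: abs_mult)
  then show ?thesis using assms(2) by (simp add: field_simps)
qed

lemma integrable_abs_powr_half:
  "integrable lborel (\<lambda>t::real. indicator {-R..R} t * \<bar>t\<bar> powr (-1/2))"
proof (cases "R \<ge> 0")
  case True
  \<comment> \<open>the two half lines overlap only at \<open>0\<close>, where the power is \<open>0\<close>\<close>
  let ?h = "\<lambda>t::real. indicator {0..R} t * t powr (-1/2)"
  have "(\<lambda>t::real. t powr (-1/2)) integrable_on {0..R}"
    by (rule integrable_on_powr_from_0) (use True in auto)
  then have "(\<lambda>t::real. t powr (-1/2)) absolutely_integrable_on {0..R}"
    by (subst absolutely_integrable_on_iff_nonneg) auto
  then have h: "integrable lborel ?h"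
    using integrable_completion[of ?h lborel] by (simp add: set_integrable_def)
  from lborel_integrable_real_affine[OF h, of "-1" 0]
  have "integrable lborel (\<lambda>t. ?h (- t))" by simp
  from Bochner_Integration.integrable_add[OF h this]
  show ?thesis
  proof (rule iffD1[OF Bochner_Integration.integrable_cong[OF refl], rotated])
    fix t :: real
    show "?h t + ?h (-t) = indicator {-R..R} t * \<bar>t\<bar> powr (-1/2)"
      by (cases "t = 0"; cases "t > 0") (auto simp: indicator_def)
  qed
qed simp

lemma integrable_lborel_prod_Basis:
  fixes f :: "'a::euclidean_space \<Rightarrow> real \<Rightarrow> real"
  assumes "\<And>b. b \<in> Basis \<Longrightarrow> integrable lborel (f b)"
  shows "integrable lborel (\<lambda>x. \<Prod>b\<in>Basis. f b (x \<bullet> b))"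
proof -
  interpret product_sigma_finite "\<lambda>_::'a. lborel :: real measure" ..
  let ?P = "Pi\<^sub>M Basis (\<lambda>_::'a. lborel :: real measure)"
  let ?e = "\<lambda>y. \<Sum>c\<in>Basis. y c *\<^sub>R c :: 'a"
  have m: "?e \<in> measurable ?P borel" by measurable
  have f: "(\<lambda>x. \<Prod>b\<in>Basis. f b (x \<bullet> b)) \<in> borel_measurable borel"
  proof (rule borel_measurable_prod)
    fix b :: 'a assume "b \<in> Basis"
    then have "f b \<in> borel_measurable borel" using assms by auto
    then show "(\<lambda>x. f b (x \<bullet> b)) \<in> borel_measurable borel" by measurable
  qed
  have "integrable ?P (\<lambda>y. \<Prod>b\<in>Basis. f b (y b))"
    using assms by (intro product_integrable_prod) auto
  then have "integrable ?P (\<lambda>y. \<Prod>b\<in>Basis. f b (?e y \<bullet> b))"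
    by (simp add: inner_sum_left inner_Basis if_distrib cong: if_cong prod.cong)
  then show ?thesis
    by (subst lborel_eq) (simp add: integrable_distr_eq[OF m f])
qed

text \<open>The function depends on one coordinate only, so on a cube it is a product of
  one-dimensional integrable functions.\<close>

lemma integrable_abs_coordinate_powr_half:
  fixes b :: "'a::euclidean_space"
  assumes b: "b \<in> Basis" and K: "compact K"
  shows "integrable lborel (\<lambda>x. indicator K x * \<bar>x \<bullet> b\<bar> powr (-1/2))"
proof -
  obtain R where R: "\<And>x. x \<in> K \<Longrightarrow> norm x \<le> R"
    using compact_imp_bounded[OF K] unfolding bounded_iff by auto
  let ?f = "\<lambda>c::'a. if c = b then \<lambda>t. indicator {-R..R} t * \<bar>t\<bar> powr (-1/2) else (indicator {-R..R} :: real \<Rightarrow> real)"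
  have "integrable lborel (?f c)" for c
  proof (cases "c = b")
    case True
    then show ?thesis using integrable_abs_powr_half[of R] by simp
  next
    case False
    have "integrable lborel (indicator {-R..R} :: real \<Rightarrow> real)"
      by (rule integrable_real_indicator) (auto simp: emeasure_lborel_Icc_eq)
    then show ?thesis using False by simp
  qed
  then have "integrable lborel (\<lambda>x. \<Prod>c\<in>Basis. ?f c (x \<bullet> c))"
    by (rule integrable_lborel_prod_Basis)
  then show ?thesis
  proof (rule Bochner_Integration.integrable_bound)
    have "K \<in> sets borel" using K by (simp add: borel_compact)
    then show "(\<lambda>x. indicator K x * \<bar>x \<bullet> b\<bar> powr (-1/2)) \<in> borel_measurable lborel"
      by measurable
    have "norm (indicator K x * \<bar>x \<bullet> b\<bar> powr (-1/2)) \<le> norm (\<Prod>c\<in>Basis. ?f c (x \<bullet> c))" for x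
    proof (cases "x \<in> K")
      case True
      have i: "x \<bullet> c \<in> {-R..R}" if "c \<in> Basis" for c
        using Basis_le_norm[OF that, of x] R[OF True] by auto
      have "(\<Prod>c\<in>Basis. ?f c (x \<bullet> c)) = ?f b (x \<bullet> b) * (\<Prod>c\<in>Basis-{b}. ?f c (x \<bullet> c))"
        by (rule prod.remove[OF finite_Basis b])
      also have "(\<Prod>c\<in>Basis-{b}. ?f c (x \<bullet> c)) = 1"
        by (rule prod.neutral) (use i in auto)
      finally show ?thesis using True i[OF b] by simp
    qed simp
    then show "AE x in lborel. norm (indicator K x * \<bar>x \<bullet> b\<bar> powr (-1/2))
        \<le> norm (\<Prod>c\<in>Basis. ?f c (x \<bullet> c))" by simp
  qed
qed

section \<open>Continuity and line derivatives of the displacement\<close>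

definition ln_ratio :: "real \<Rightarrow> real^3 \<Rightarrow> real"
  where "ln_ratio r x = ln (((x $ 1)\<^sup>2 + (x $ 2)\<^sup>2) / r\<^sup>2)"

lemma sum_squares_pos:
  fixes a b :: real
  shows "a \<noteq> 0 \<or> b \<noteq> 0 \<Longrightarrow> 0 < a\<^sup>2 + b\<^sup>2"
  by (simp add: sum_power2_gt_zero_iff)

text \<open>Away from the axis this is clear. Near it, with \<open>y\<close> the argument of the logarithm, the
  coordinate is at most \<open>r * y powr (1/2)\<close> while the logarithm is at most a multiple of
  \<open>y powr (1/4) + y powr (-1/4)\<close>, so the product tends to \<open>0\<close>.\<close>

lemma continuous_coordinate_ln_ratio:
  assumes r: "r > 0" and i: "i = 1 \<or> i = (2::3)"
  shows "continuous_on UNIV (\<lambda>x. x $ i * ln_ratio r x)"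
proof (intro continuous_at_imp_continuous_on ballI)
  fix a :: "real^3"
  let ?q = "\<lambda>x::real^3. ((x $ 1)\<^sup>2 + (x $ 2)\<^sup>2) / r\<^sup>2"
  show "isCont (\<lambda>x. x $ i * ln_ratio r x) a"
  proof (cases "a $ 1 = 0 \<and> a $ 2 = 0")
    case False
    then have "?q a \<noteq> 0" using r sum_squares_pos[of "a $ 1" "a $ 2"] by auto
    then show ?thesis using r unfolding ln_ratio_def by (intro continuous_intros) auto
  next
    case True
    let ?m = "\<lambda>x. 4 * r * (?q x powr (3/4) + ?q x powr (1/4))"
    have bound: "\<bar>x $ i * ln_ratio r x\<bar> \<le> ?m x" for x
    proof (cases "?q x = 0")
      case True
      then have "ln (?q x) = 0" by (simp only: ln_0)
      then show ?thesis using r by (simp add: ln_ratio_def)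
    next
      case False
      then have q: "?q x > 0" by (simp add: less_le)
      have "(x $ i)\<^sup>2 \<le> r\<^sup>2 * ?q x" using r i by auto
      then have "\<bar>x $ i\<bar> \<le> sqrt (r\<^sup>2 * ?q x)" by (rule real_le_rsqrt[of "\<bar>x $ i\<bar>", simplified])
      also have "\<dots> = r * ?q x powr (1/2)"
        unfolding real_sqrt_mult powr_half_sqrt[OF less_imp_le[OF q]] using r by simp
      finally have "\<bar>x $ i\<bar> * \<bar>ln_ratio r x\<bar>
          \<le> (r * ?q x powr (1/2)) * ((?q x powr (1/4) + ?q x powr (-(1/4))) / (1/4))"
        unfolding ln_ratio_def using r by (intro mult_mono abs_ln_le_powr q) auto
      also have "\<dots> = 4 * r * (?q x powr (1/2 + 1/4) + ?q x powr (1/2 + -(1/4)))"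
        unfolding powr_add by (simp add: algebra_simps)
      finally show ?thesis by (simp add: abs_mult)
    qed
    have lim: "(?m \<longlongrightarrow> 0) (at a)"
    proof -
      have "continuous_on UNIV ?m"
        using r by (intro continuous_intros continuous_on_powr') auto
      then have "isCont ?m a" by (simp add: continuous_on_eq_continuous_at)
      then show ?thesis using True by (simp add: isCont_def)
    qed
    have "((\<lambda>x. x $ i * ln_ratio r x) \<longlongrightarrow> 0) (at a)"
      by (rule Lim_null_comparison[OF _ lim]) (use bound in simp)
    then show ?thesis using True i by (auto simp: isCont_def)
  qed
qed

lemma u_components:
  "u s r x $ 1 = x $ 1 / 4 - s * (3/4) * (x $ 2 * ln_ratio r x)"
  "u s r x $ 2 = x $ 2 / 4 + s * (3/4) * (x $ 1 * ln_ratio r x)"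
  "u s r x $ 3 = - (x $ 3 / 2)"
  by (simp_all add: u_def w_def ln_ratio_def)

lemma continuous_u:
  assumes "r > 0"
  shows "continuous_on UNIV (u s r)"
proof -
  have "continuous_on UNIV (\<lambda>x. u s r x $ i)" for i
  proof -
    have "\<forall>i. continuous_on UNIV (\<lambda>x. u s r x $ i)"
      unfolding forall_3 u_components
      using continuous_coordinate_ln_ratio[OF assms, of 1] continuous_coordinate_ln_ratio[OF assms, of 2]
      by (auto intro!: continuous_intros)
    then show ?thesis ..
  qed
  then have "continuous_on UNIV (\<lambda>x. \<chi> i. u s r x $ i)" by (rule continuous_on_vec_lambda)
  then show ?thesis by simp
qed

text \<open>The classical gradient of \<open>u\<close> off the axis. On the axis the quotients and the logarithm
  evaluate to \<open>0\<close>, so the third column is the derivative in direction \<open>3\<close> there as well.\<close>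

definition grad_u :: "real \<Rightarrow> real \<Rightarrow> real^3 \<Rightarrow> real^3^3" where
  "grad_u s r x = (let c = s * (3/4); q = (x $ 1)\<^sup>2 + (x $ 2)\<^sup>2 in
    vector [vector [1/4 - c * (2 * (x $ 1 * x $ 2) / q), - (c * (ln_ratio r x + 2 * (x $ 2)\<^sup>2 / q)), 0],
            vector [c * (ln_ratio r x + 2 * (x $ 1)\<^sup>2 / q), 1/4 + c * (2 * (x $ 1 * x $ 2) / q), 0],
            vector [0, 0, - (1/2)]])"


text \<open>A line in direction \<open>1\<close> or \<open>2\<close> meets the axis in at most the one point excluded here. On a
  line in direction \<open>3\<close> the logarithm is constant, even if the line is the axis itself, so nothing
  has to be excluded.\<close>

lemma u_line_derivative:
  assumes r: "r > 0"
  shows "\<exists>F. finite F \<and> (\<forall>t. t \<notin> F \<longrightarrow>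
      ((\<lambda>t. u s r (x + t *\<^sub>R axis j 1) $ i) has_real_derivative
         grad_u s r (x + t *\<^sub>R axis j 1) $ i $ j) (at t))"
proof (intro exI conjI allI impI)
  let ?F = "if j = 3 then {} else {- x $ j}"
  show "finite ?F" by simp
  fix t assume t: "t \<notin> ?F"
  consider "j = 1" | "j = 2" | "j = 3" using exhaust_3 by blast
  then show "((\<lambda>t. u s r (x + t *\<^sub>R axis j 1) $ i) has_real_derivative
         grad_u s r (x + t *\<^sub>R axis j 1) $ i $ j) (at t)"
  proof cases
    case 1
    let ?l = "\<lambda>t. ln_ratio r (x + t *\<^sub>R axis j 1)" and ?Q = "(x $ 1 + t)\<^sup>2 + (x $ 2)\<^sup>2" and ?c = "s * (3/4)"
    define d where "d = 2 * (x $ 1 + t) / ?Q"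
    have "x $ 1 + t \<noteq> 0" using t 1 by auto
    then have q: "?Q > 0"
      by (intro sum_squares_pos) simp
    have comp: "(x + t *\<^sub>R axis j 1) $ 1 = x $ 1 + t" "(x + t *\<^sub>R axis j 1) $ 2 = x $ 2"
      "(x + t *\<^sub>R axis j 1) $ 3 = x $ 3" for t
      by (simp_all add: axis_def 1)
    have L: "(?l has_real_derivative d) (at t)"
      unfolding ln_ratio_def comp d_def using r q
      by (auto intro!: derivative_eq_intros simp: divide_simps)
    have d: "x $ 2 * d = 2 * ((x $ 1 + t) * (x $ 2)) / ?Q" "(x $ 1 + t) * d = 2 * (x $ 1 + t)\<^sup>2 / ?Q"
      by (simp_all add: d_def power2_eq_square)
    have "((\<lambda>t. x $ 2 * ?l t) has_real_derivative x $ 2 * d) (at t)"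
      by (rule DERIV_cmult[OF L])
    note D1 = this[unfolded d]
    have "((\<lambda>t. (x $ 1 + t) * ?l t) has_real_derivative 1 * ?l t + d * (x $ 1 + t)) (at t)"
      by (rule DERIV_mult[OF _ L]) (auto intro!: derivative_eq_intros)
    then have D2: "((\<lambda>t. (x $ 1 + t) * ?l t) has_real_derivative ?l t + 2 * (x $ 1 + t)\<^sup>2 / ?Q) (at t)"
      using d(2) by (simp add: mult.commute)
    have D0: "((\<lambda>t. (x $ 1 + t) / 4) has_real_derivative 1 / 4) (at t)"
      by (auto intro!: derivative_eq_intros)
    have "\<forall>i. ((\<lambda>t. u s r (x + t *\<^sub>R axis j 1) $ i) has_real_derivative
         grad_u s r (x + t *\<^sub>R axis j 1) $ i $ j) (at t)"
      unfolding forall_3 u_components grad_u_def Let_def comp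
      using DERIV_diff[OF D0 DERIV_cmult[OF D1, of ?c]] DERIV_add[OF DERIV_const[of "x $ 2 / 4"] DERIV_cmult[OF D2, of ?c]]
      by (simp add: 1)
    then show ?thesis ..
  next
    case 2
    let ?l = "\<lambda>t. ln_ratio r (x + t *\<^sub>R axis j 1)" and ?Q = "(x $ 1)\<^sup>2 + (x $ 2 + t)\<^sup>2" and ?c = "s * (3/4)"
    define d where "d = 2 * (x $ 2 + t) / ?Q"
    have "x $ 2 + t \<noteq> 0" using t 2 by auto
    then have q: "?Q > 0"
      by (intro sum_squares_pos) simp
    have comp: "(x + t *\<^sub>R axis j 1) $ 1 = x $ 1" "(x + t *\<^sub>R axis j 1) $ 2 = x $ 2 + t"
      "(x + t *\<^sub>R axis j 1) $ 3 = x $ 3" for t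
      by (simp_all add: axis_def 2)
    have L: "(?l has_real_derivative d) (at t)"
      unfolding ln_ratio_def comp d_def using r q
      by (auto intro!: derivative_eq_intros simp: divide_simps)
    have d: "x $ 1 * d = 2 * ((x $ 1) * (x $ 2 + t)) / ?Q" "(x $ 2 + t) * d = 2 * (x $ 2 + t)\<^sup>2 / ?Q"
      by (simp_all add: d_def power2_eq_square)
    have "((\<lambda>t. x $ 1 * ?l t) has_real_derivative x $ 1 * d) (at t)"
      by (rule DERIV_cmult[OF L])
    note D1 = this[unfolded d]
    have "((\<lambda>t. (x $ 2 + t) * ?l t) has_real_derivative 1 * ?l t + d * (x $ 2 + t)) (at t)"
      by (rule DERIV_mult[OF _ L]) (auto intro!: derivative_eq_intros)
    then have D2: "((\<lambda>t. (x $ 2 + t) * ?l t) has_real_derivative ?l t + 2 * (x $ 2 + t)\<^sup>2 / ?Q) (at t)"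
      using d(2) by (simp add: mult.commute)
    have D0: "((\<lambda>t. (x $ 2 + t) / 4) has_real_derivative 1 / 4) (at t)"
      by (auto intro!: derivative_eq_intros)
    have "\<forall>i. ((\<lambda>t. u s r (x + t *\<^sub>R axis j 1) $ i) has_real_derivative
         grad_u s r (x + t *\<^sub>R axis j 1) $ i $ j) (at t)"
      unfolding forall_3 u_components grad_u_def Let_def comp
      using DERIV_diff[OF DERIV_const[of "x $ 1 / 4"] DERIV_cmult[OF D2, of ?c]] DERIV_add[OF D0 DERIV_cmult[OF D1, of ?c]]
      by (simp add: 2)
    then show ?thesis ..
  next
    case 3
    then have "\<forall>i. ((\<lambda>t. u s r (x + t *\<^sub>R axis j 1) $ i) has_real_derivative
         grad_u s r (x + t *\<^sub>R axis j 1) $ i $ j) (at t)"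
      unfolding forall_3 3 u_components grad_u_def Let_def ln_ratio_def
      by (auto intro!: derivative_eq_intros simp: axis_def)
    then show ?thesis ..
  qed
qed

section \<open>Local integrability of powers of the gradient\<close>

lemma grad_u_measurable: "grad_u s r \<in> borel_measurable borel"
proof -
  have nth: "(\<lambda>x::real^3. x $ k) \<in> borel_measurable borel" for k
    by (intro borel_measurable_continuous_onI continuous_intros)
  have "\<forall>i j. (\<lambda>x. grad_u s r x $ i $ j) \<in> borel_measurable borel"
    unfolding forall_3 grad_u_def Let_def ln_ratio_def using nth[measurable] by simp
  then have entry: "(\<lambda>x. grad_u s r x $ i $ j) \<in> borel_measurable borel" for i j
    by blast
  show ?thesis
    unfolding borel_measurable_euclidean_space[of "grad_u s r"]
  proof
    fix b :: "real^3^3" assume "b \<in> Basis"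
    then obtain i j where "b = axis i (axis j 1)"
      by (auto simp: Basis_vec_def)
    then show "(\<lambda>x. grad_u s r x \<bullet> b) \<in> borel_measurable borel"
      using entry[of i j] by (simp add: inner_axis)
  qed
qed

text \<open>All entries are bounded except for multiples of the logarithm, since
  \<open>x $ i * x $ j / ((x $ 1)\<^sup>2 + (x $ 2)\<^sup>2)\<close> is bounded for \<open>i, j \<in> {1, 2}\<close>.\<close>

lemma norm_grad_u_le:
  assumes "\<bar>s\<bar> = 1"
  shows "norm (grad_u s r x) \<le> 18 + 9 * \<bar>ln_ratio r x\<bar>"
proof -
  let ?q = "(x $ 1)\<^sup>2 + (x $ 2)\<^sup>2"
  have frac: "\<bar>z / ?q\<bar> \<le> 1" if "\<bar>z\<bar> \<le> ?q" for z
    using that by (auto simp: abs_divide intro!: divide_le_eq_1[THEN iffD2] simp del: sum_power2_eq_zero_iff)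
  define c P A B where "c = s * (3/4)" and "P = 2 * (x $ 1 * x $ 2) / ?q"
    and "A = 2 * (x $ 1)\<^sup>2 / ?q" and "B = 2 * (x $ 2)\<^sup>2 / ?q"
  have P: "\<bar>P\<bar> \<le> 1"
    unfolding P_def using sum_squares_bound[of "x $ 1" "x $ 2"] sum_squares_bound[of "x $ 1" "- (x $ 2)"]
    by (intro frac abs_leI) auto
  have A: "\<bar>A\<bar> \<le> 2" using frac[of "(x $ 1)\<^sup>2"] by (simp add: A_def abs_mult)
  have B: "\<bar>B\<bar> \<le> 2" using frac[of "(x $ 2)\<^sup>2"] by (simp add: B_def abs_mult)
  have c: "\<bar>c * z\<bar> \<le> \<bar>z\<bar>" for z
    using assms by (simp add: c_def abs_mult)
  have G: "grad_u s r x = vector [vector [1/4 - c * P, - (c * (ln_ratio r x + B)), 0],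
      vector [c * (ln_ratio r x + A), 1/4 + c * P, 0], vector [0, 0, - (1/2)]]"
    by (simp add: grad_u_def Let_def c_def P_def A_def B_def)
  have "\<bar>1/4 - c * P\<bar> \<le> 2 + \<bar>ln_ratio r x\<bar>" "\<bar>1/4 + c * P\<bar> \<le> 2 + \<bar>ln_ratio r x\<bar>"
    using c[of P] P by linarith+
  moreover have "\<bar>c * (ln_ratio r x + A)\<bar> \<le> 2 + \<bar>ln_ratio r x\<bar>"
    using c[of "ln_ratio r x + A"] A by linarith
  moreover have "\<bar>c * (ln_ratio r x + B)\<bar> \<le> 2 + \<bar>ln_ratio r x\<bar>"
    using c[of "ln_ratio r x + B"] B by linarith
  ultimately have "\<forall>i j. \<bar>grad_u s r x $ i $ j\<bar> \<le> 2 + \<bar>ln_ratio r x\<bar>"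
    unfolding forall_3 G by simp
  then have entry: "\<bar>grad_u s r x $ i $ j\<bar> \<le> 2 + \<bar>ln_ratio r x\<bar>" for i j by blast
  have row: "norm (grad_u s r x $ i) \<le> 3 * (2 + \<bar>ln_ratio r x\<bar>)" for i
  proof -
    have "norm (grad_u s r x $ i) \<le> (\<Sum>j\<in>UNIV. \<bar>grad_u s r x $ i $ j\<bar>)"
      by (rule norm_le_l1_cart)
    also have "\<dots> \<le> (\<Sum>j\<in>(UNIV::3 set). 2 + \<bar>ln_ratio r x\<bar>)"
      by (intro sum_mono entry)
    finally show ?thesis by simp
  qed
  have "norm (grad_u s r x) \<le> (\<Sum>i\<in>UNIV. norm (grad_u s r x $ i))"
    by (simp add: norm_vec_def L2_set_le_sum)
  also have "\<dots> \<le> (\<Sum>i\<in>(UNIV::3 set). 3 * (2 + \<bar>ln_ratio r x\<bar>))"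
    by (intro sum_mono row)
  finally show ?thesis by simp
qed

text \<open>The squared distance to the axis is at least \<open>(x $ 1)\<^sup>2\<close>, which turns the singularity on a
  line into a power of a single coordinate; the exponent \<open>-d\<close> can be as close to \<open>0\<close> as desired. The
  bounded terms are absorbed because \<open>\<bar>x $ 1\<bar> powr (-d)\<close> has a positive lower bound on
  the ball.\<close>

lemma ln_ratio_le_powr:
  fixes r d R \<alpha> \<beta> :: real
  assumes r: "r > 0" and d: "d > 0" and ab: "\<alpha> \<ge> 0" "\<beta> \<ge> 0"
  obtains C where "C \<ge> 0"
    "\<And>x. x $ 1 \<noteq> 0 \<Longrightarrow> norm x \<le> R \<Longrightarrow> \<alpha> + \<beta> * \<bar>ln_ratio r x\<bar> \<le> C * \<bar>x $ 1\<bar> powr (-d)"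
proof -
  define A where "A = ((R\<^sup>2 + R\<^sup>2) / r\<^sup>2) powr (d/2)"
  define C where "C = (\<alpha> + \<beta> * (A / (d/2))) * R powr d + \<beta> * (r powr d / (d/2))"
  have "A \<ge> 0" by (simp add: A_def)
  have "\<alpha> + \<beta> * \<bar>ln_ratio r x\<bar> \<le> C * \<bar>x $ 1\<bar> powr (-d)" if x: "x $ 1 \<noteq> 0" "norm x \<le> R" for x
  proof -
    let ?y = "((x $ 1)\<^sup>2 + (x $ 2)\<^sup>2) / r\<^sup>2"
    have c: "\<bar>x $ 1\<bar> \<le> R" "\<bar>x $ 2\<bar> \<le> R"
      using component_le_norm_cart[of x 1] component_le_norm_cart[of x 2] x(2) by auto
    have y: "?y > 0" using x r sum_squares_pos[of "x $ 1" "x $ 2"] by simp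
    have "(x $ 1)\<^sup>2 + (x $ 2)\<^sup>2 \<le> R\<^sup>2 + R\<^sup>2"
      using power_mono[OF c(1), of 2] power_mono[OF c(2), of 2] by simp
    then have 1: "?y powr (d/2) \<le> A"
      unfolding A_def using y d r by (intro powr_mono2 divide_right_mono) auto
    have "?y powr (-(d/2)) \<le> ((\<bar>x $ 1\<bar> / r)\<^sup>2) powr (-(d/2))"
      using x r d by (intro powr_mono2') (auto simp: power_divide divide_right_mono)
    also have "\<dots> = (\<bar>x $ 1\<bar> / r) powr (-d)"
      using x r by (simp add: powr_numeral[symmetric] powr_powr del: powr_numeral)
    also have "\<dots> = r powr d * \<bar>x $ 1\<bar> powr (-d)"
      using x r by (simp add: powr_divide powr_minus field_simps)
    finally have 2: "?y powr (-(d/2)) \<le> r powr d * \<bar>x $ 1\<bar> powr (-d)" .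
    have "(\<bar>x $ 1\<bar> / R) powr d \<le> 1"
      using c x d by (intro powr_le1) auto
    then have 3: "1 \<le> R powr d * \<bar>x $ 1\<bar> powr (-d)"
      using x c by (simp add: powr_divide powr_minus field_simps)
    have "\<bar>ln_ratio r x\<bar> \<le> (?y powr (d/2) + ?y powr (-(d/2))) / (d/2)"
      unfolding ln_ratio_def using y d by (intro abs_ln_le_powr) auto
    also have "\<dots> \<le> (A + r powr d * \<bar>x $ 1\<bar> powr (-d)) / (d/2)"
      using 1 2 d by (intro divide_right_mono add_mono) auto
    finally have "\<alpha> + \<beta> * \<bar>ln_ratio r x\<bar>
        \<le> \<alpha> + \<beta> * ((A + r powr d * \<bar>x $ 1\<bar> powr (-d)) / (d/2))"
      using ab by (intro add_left_mono mult_left_mono) auto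
    also have "\<dots> = (\<alpha> + \<beta> * (A / (d/2))) * 1 + \<beta> * (r powr d / (d/2)) * \<bar>x $ 1\<bar> powr (-d)"
      by (simp add: add_divide_distrib algebra_simps)
    also have "\<dots> \<le> (\<alpha> + \<beta> * (A / (d/2))) * (R powr d * \<bar>x $ 1\<bar> powr (-d))
        + \<beta> * (r powr d / (d/2)) * \<bar>x $ 1\<bar> powr (-d)"
      using 3 \<open>A \<ge> 0\<close> d ab by (intro add_right_mono mult_left_mono) auto
    also have "\<dots> = C * \<bar>x $ 1\<bar> powr (-d)"
      by (simp add: C_def distrib_right mult.assoc)
    finally show ?thesis .
  qed
  moreover have "C \<ge> 0" unfolding C_def using \<open>A \<ge> 0\<close> d ab by (intro add_nonneg_nonneg mult_nonneg_nonneg) auto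
  ultimately show ?thesis using that by blast
qed

lemma AE_coordinate_nonzero: "AE x::real^'n in lebesgue. x $ k \<noteq> 0"
proof -
  have "AE x in lebesgue. x \<notin> {x::real^'n. x $ k = 0}"
    using negligible_standard_hyperplane_cart[of k]
    by (intro AE_not_in) (simp add: negligible_iff_null_sets)
  then show ?thesis by simp
qed

text \<open>With exponent \<open>-1/(2*p)\<close> in the bound for the gradient, its \<open>p\<close>-th power is dominated by
  the integrable function \<open>\<bar>x $ 1\<bar> powr (-1/2)\<close>.\<close>

lemma norm_grad_u_powr_integrable:
  assumes r: "r > 0" and s: "\<bar>s\<bar> = 1" and p: "p \<ge> 1" and K: "compact K"
  shows "set_integrable lebesgue K (\<lambda>x. norm (grad_u s r x) powr p)"
proof -
  let ?g = "\<lambda>x. indicator K x * norm (grad_u s r x) powr p"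
  let ?b = "axis 1 1 :: real^3"
  obtain R where R: "\<And>x. x \<in> K \<Longrightarrow> norm x \<le> R"
    using compact_imp_bounded[OF K] unfolding bounded_iff by auto
  obtain C where C: "C \<ge> 0"
    "\<And>x. x $ 1 \<noteq> 0 \<Longrightarrow> norm x \<le> R \<Longrightarrow> 18 + 9 * \<bar>ln_ratio r x\<bar> \<le> C * \<bar>x $ 1\<bar> powr (-(1/(2*p)))"
    using ln_ratio_le_powr[OF r, of "1/(2*p)" 18 9 R] p by auto
  have Kb: "K \<in> sets borel" using K by (simp add: borel_compact)
  have m: "?g \<in> borel_measurable lborel"
    using grad_u_measurable[of s r] Kb by measurable
  have "integrable lborel (\<lambda>x. C powr p * (indicator K x * \<bar>x \<bullet> ?b\<bar> powr (-1/2)))"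
    by (intro integrable_mult_right integrable_abs_coordinate_powr_half K) (simp add: axis_in_Basis_iff)
  then have "integrable lborel ?g"
  proof (rule Bochner_Integration.integrable_bound[OF _ m])
    have "AE x::real^3 in lborel. x $ 1 \<noteq> 0"
      using AE_coordinate_nonzero[of 1] by (simp add: AE_completion_iff)
    then show "AE x in lborel. norm (?g x)
        \<le> norm (C powr p * (indicator K x * \<bar>x \<bullet> ?b\<bar> powr (-1/2)))"
    proof eventually_elim
      case (elim x)
      show ?case
      proof (cases "x \<in> K")
        case True
        have "norm (grad_u s r x) \<le> C * \<bar>x $ 1\<bar> powr (-(1/(2*p)))"
          using norm_grad_u_le[OF s, of r x] C(2)[OF elim R[OF True]] by linarith
        then have "norm (grad_u s r x) powr p \<le> (C * \<bar>x $ 1\<bar> powr (-(1/(2*p)))) powr p"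
          using p by (intro powr_mono2) auto
        also have "\<dots> = C powr p * \<bar>x $ 1\<bar> powr (-1/2)"
          using C(1) p by (simp add: powr_mult powr_powr)
        finally show ?thesis using True by (simp add: inner_axis)
      qed simp
    qed
  qed
  then show ?thesis
    using integrable_completion[OF m] by (simp add: set_integrable_def)
qed

lemma grad_u_locally_integrable:
  assumes "r > 0" and "\<bar>s\<bar> = 1"
  shows "locally_integrable S (grad_u s r)"
  unfolding locally_integrable_def
proof (intro allI impI)
  fix K assume K: "compact K \<and> K \<subseteq> S"
  then have "K \<in> sets borel" by (simp add: borel_compact)
  then have m: "(\<lambda>x. indicator K x *\<^sub>R grad_u s r x) \<in> borel_measurable lborel"
    using grad_u_measurable[of s r] by measurable
  have "integrable lebesgue (\<lambda>x. norm (indicator K x *\<^sub>R grad_u s r x))"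
    using norm_grad_u_powr_integrable[OF assms, of 1 K] K by (simp add: set_integrable_def)
  then show "set_integrable lebesgue K (grad_u s r)"
    unfolding set_integrable_def using measurable_completion[OF m] by (simp only: integrable_norm_iff)
qed

section \<open>The symmetric gradient, the boundary values and the conclusion\<close>

lemma V_U_eq_0:
  assumes "norm n = 1"
  shows "V (U n) = 0"
proof -
  have "V (U n) \<le> 0" using V_minimum(2)[of n "U n"] assms by simp
  moreover have "V (U n) \<ge> 0" using V_minimum(1)[of "U n"] by auto
  ultimately show ?thesis by simp
qed

text \<open>In polar coordinates with angle \<open>\<theta>\<close> the horizontal block of the symmetric gradient is
  \<open>1/4\<close> times the identity plus \<open>3/4\<close> times the trace-free matrix with first row
  \<open>(- s * sin (2 * \<theta>), s * cos (2 * \<theta>))\<close>. For a horizontal unit vector \<open>n\<close> with angle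
  \<open>\<psi>\<close> the matrix \<open>U n\<close> has the same form with first row \<open>(cos (2 * \<psi>), sin (2 * \<psi>))\<close>.
  Hence \<open>\<psi> = \<theta> + s * pi / 4\<close>: the vector \<open>n\<close> is the radial direction turned by \<open>45\<close> degrees.\<close>

lemma V_sym_part_grad_u:
  assumes s: "s \<in> {1, -1}" and x: "x $ 1 \<noteq> 0 \<or> x $ 2 \<noteq> 0"
  shows "V (sym_part (grad_u s r x)) = 0"
proof -
  define q where "q = (x $ 1)\<^sup>2 + (x $ 2)\<^sup>2"
  define k where "k = 1 / sqrt (2 * q)"
  define n :: "real^3" where "n = vector [k * (x $ 1 - s * x $ 2), k * (x $ 2 + s * x $ 1), 0]"
  have q: "q > 0" unfolding q_def by (rule sum_squares_pos[OF x])
  have k: "k\<^sup>2 = 1 / (2 * q)" using q by (simp add: k_def power_divide)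
  have s2: "s\<^sup>2 = 1" using s by auto
  have "n \<bullet> n = k\<^sup>2 * ((1 + s\<^sup>2) * q)"
    by (simp add: inner_vec_def sum_3 n_def q_def power2_eq_square algebra_simps)
  then have "norm n = 1" using q by (simp add: norm_eq_sqrt_inner k s2)
  moreover have "sym_part (grad_u s r x) = U n"
  proof -
    have n11: "n $ 1 * n $ 1 = 1/2 - s * (x $ 1 * x $ 2) / q"
    proof -
      have "n $ 1 * n $ 1 = k\<^sup>2 * ((x $ 1)\<^sup>2 + s\<^sup>2 * (x $ 2)\<^sup>2 - 2 * s * (x $ 1 * x $ 2))"
        by (simp add: n_def power2_eq_square algebra_simps)
      also have "\<dots> = (q - 2 * s * (x $ 1 * x $ 2)) / (2 * q)" by (simp add: k s2 q_def)
      finally show ?thesis using q by (simp add: field_simps)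
    qed
    have n22: "n $ 2 * n $ 2 = 1/2 + s * (x $ 1 * x $ 2) / q"
    proof -
      have "n $ 2 * n $ 2 = k\<^sup>2 * ((x $ 2)\<^sup>2 + s\<^sup>2 * (x $ 1)\<^sup>2 + 2 * s * (x $ 1 * x $ 2))"
        by (simp add: n_def power2_eq_square algebra_simps)
      also have "\<dots> = (q + 2 * s * (x $ 1 * x $ 2)) / (2 * q)" by (simp add: k s2 q_def add.commute)
      finally show ?thesis using q by (simp add: field_simps)
    qed
    have n12: "n $ 1 * n $ 2 = s * (x $ 1)\<^sup>2 / (2 * q) - s * (x $ 2)\<^sup>2 / (2 * q)"
    proof -
      have "n $ 1 * n $ 2 = k\<^sup>2 * ((1 - s\<^sup>2) * (x $ 1 * x $ 2) + s * (x $ 1)\<^sup>2 - s * (x $ 2)\<^sup>2)"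
        by (simp add: n_def power2_eq_square algebra_simps)
      then show ?thesis by (simp add: k s2 diff_divide_distrib)
    qed
    have n21: "n $ 2 * n $ 1 = s * (x $ 1)\<^sup>2 / (2 * q) - s * (x $ 2)\<^sup>2 / (2 * q)"
      using n12 by (simp add: mult.commute)
    have n3: "n $ 3 = 0" by (simp add: n_def)
    show ?thesis
      unfolding vec_eq_iff forall_3
      by (simp add: sym_part_def U_def transpose_def mat_def grad_u_def Let_def n11 n22 n12 n21 n3
          q_def[symmetric] algebra_simps)
  qed
  ultimately show ?thesis by (simp add: V_U_eq_0)
qed

lemma frontier_cylinder:
  assumes x: "x \<in> frontier (cylinder r)" and r: "r > 0"
  shows "(x $ 1)\<^sup>2 + (x $ 2)\<^sup>2 = r\<^sup>2"
proof -
  let ?q = "\<lambda>x::real^3. (x $ 1)\<^sup>2 + (x $ 2)\<^sup>2"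
  have "norm (vector [a, b] :: real^2) = sqrt (a\<^sup>2 + b\<^sup>2)" for a b
    by (simp add: norm_vec_def L2_set_def sum_2)
  then have cyl: "cylinder r = {x. ?q x < r\<^sup>2}"
    using r real_sqrt_less_iff[of _ "r\<^sup>2"] by (simp add: cylinder_def)
  have "open {x. ?q x < r\<^sup>2}" by (intro open_Collect_less continuous_intros)
  moreover have "closure {x. ?q x < r\<^sup>2} \<subseteq> {x. ?q x \<le> r\<^sup>2}"
    by (intro closure_minimal closed_Collect_le continuous_intros) auto
  ultimately show ?thesis
    using x unfolding cyl frontier_def by (auto simp: interior_open)
qed

lemma Lp_open_subset:
  fixes f :: "'a::euclidean_space \<Rightarrow> 'b::euclidean_space"
  assumes f: "f \<in> borel_measurable borel" and T: "open T" "T \<subseteq> K"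
    and int: "set_integrable lebesgue K (\<lambda>x. norm (f x) powr p)"
  shows "Lp p T f"
  unfolding Lp_def
proof
  have "(\<lambda>x. indicator T x *\<^sub>R f x) \<in> borel_measurable lborel"
    using f borel_open[OF T(1)] by (intro borel_measurable_scaleR borel_measurable_indicator) simp_all
  then show "set_borel_measurable lebesgue T f"
    unfolding set_borel_measurable_def by (rule measurable_completion)
  show "set_integrable lebesgue T (\<lambda>x. norm (f x) powr p)"
    by (rule set_integrable_subset[OF int]) (use T in auto)
qed

theorem theorem2p1:
  fixes r s :: real
  assumes "r > 0" and "s \<in> {1, -1}"
  shows "(\<exists>G. has_weak_gradient (cylinder r) (u s r) G \<and>
              (AE x in lebesgue. x \<in> cylinder r \<longrightarrow> V (sym_part (G x)) = 0))
       \<and> (\<forall>x \<in> frontier (cylinder r). u s r x = w x)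
       \<and> (\<forall>p\<ge>1. W1p_loc p (cylinder r) (u s r))"
proof (intro conjI)
  have s: "\<bar>s\<bar> = 1" using assms(2) by auto
  have weak: "has_weak_gradient S (u s r) (grad_u s r)" for S
    by (rule has_weak_gradient_by_lines[OF continuous_u[OF assms(1)] grad_u_measurable
          grad_u_locally_integrable[OF assms(1) s] u_line_derivative[OF assms(1)]])
  have "AE x in lebesgue. x \<in> cylinder r \<longrightarrow> V (sym_part (grad_u s r x)) = 0"
    using AE_coordinate_nonzero[of 1] by eventually_elim (simp add: V_sym_part_grad_u[OF assms(2)])
  then show "\<exists>G. has_weak_gradient (cylinder r) (u s r) G \<and>
      (AE x in lebesgue. x \<in> cylinder r \<longrightarrow> V (sym_part (G x)) = 0)"
    using weak by blast
  show "\<forall>x \<in> frontier (cylinder r). u s r x = w x"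
    using frontier_cylinder[OF _ assms(1)] assms(1) by (simp add: u_def)
  show "\<forall>p\<ge>1. W1p_loc p (cylinder r) (u s r)"
    unfolding W1p_loc_def W1p_def
  proof (intro allI impI conjI exI)
    fix p :: real and T assume p: "p \<ge> 1"
      and "open T \<and> compact (closure T) \<and> closure T \<subseteq> cylinder r"
    then have T: "open T" "T \<subseteq> closure T" "compact (closure T)" by (auto simp: closure_subset)
    have "continuous_on UNIV (\<lambda>x. norm (u s r x) powr p)"
      using p by (intro continuous_on_powr' continuous_intros continuous_u assms) auto
    then have "set_integrable lebesgue (closure T) (\<lambda>x. norm (u s r x) powr p)"
      using locally_integrable_continuous[of _ "closure T"] T(3) unfolding locally_integrable_def by blast
    with T(1,2) show "Lp p T (u s r)"
      by (intro Lp_open_subset borel_measurable_continuous_onI[OF continuous_u] assms)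
    show "has_weak_gradient T (u s r) (grad_u s r)" by (rule weak)
    show "Lp p T (grad_u s r)"
      using T by (intro Lp_open_subset grad_u_measurable norm_grad_u_powr_integrable assms s p)
  qed
qed

end
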